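(* Let $D$ be a strongly connected digraph with $n\geq 4$ vertices such that for any two adjacent vertices $x$ and $y$ of $D$ the inequality $\deg(x)+\deg(y)\geq n+2$ holds. Then $D$ has two (distinct) noncritical vertices.
   Context: Digraphs are finite, without loops and without multiple arcs: any two distinct vertices $x$ and $y$ are connected by at most two arcs, at most one in each direction (both arcs $xy$ and $yx$ may be present simultaneously). Two distinct vertices are adjacent if there is at least one arc between them, in either direction. A digraph is strongly connected if for any two of its vertices $x,y$ there is a directed path from $x$ to $y$. The degree $\deg(x)$ of a vertex $x$ in $D$ is the number of vertices adjacent to $x$; if $x$ and $y$ are connected by two arcs, then $y$ is counted once. $D-v$ denotes the digraph obtained from $D$ by deleting the vertex $v$ and all arcs incident to $v$. A vertex $v$ of a strongly connected digraph $D$ is called noncritical if the digraph $D-v$ is strongly connected. "Has two noncritical vertices" means that at least two distinct noncritical vertices exist. *)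

theory Defs
  imports "Graph_Theory.Digraph_Component"
begin

definition adjacent :: "('a, 'b) pre_digraph \<Rightarrow> 'a \<Rightarrow> 'a \<Rightarrow> bool" where
  "adjacent D x y \<longleftrightarrow> x \<noteq> y \<and> (x \<rightarrow>\<^bsub>D\<^esub> y \<or> y \<rightarrow>\<^bsub>D\<^esub> x)"

text \<open>Unlike the sum of the library's in-degree and out-degree, this counts neighbouring
  vertices rather than arcs, so a neighbour joined by arcs in both directions counts once.\<close>

definition deg :: "('a, 'b) pre_digraph \<Rightarrow> 'a \<Rightarrow> nat" where
  "deg D x = card {y \<in> verts D. adjacent D x y}"

definition noncritical :: "('a, 'b) pre_digraph \<Rightarrow> 'a \<Rightarrow> bool" where
  "noncritical D v \<longleftrightarrow> v \<in> verts D \<and> strongly_connected (pre_digraph.del_vert D v)"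

end

theory Submission
  imports Defs
begin

text \<open>Let \<open>T\<close> be a maximal proper strongly connected vertex set containing a given vertex \<open>v\<close>. By
  maximality all arcs leaving \<open>T\<close> end in one vertex \<open>a\<close> and all arcs entering it start in one
  vertex \<open>b\<close>. If \<open>a = b\<close>, then \<open>T\<close> is the complement of a noncritical vertex other than \<open>v\<close>.
  Otherwise the degree condition leaves no room for a vertex outside \<open>T\<close> other than \<open>a\<close> and \<open>b\<close>, so
  \<open>a\<close>, \<open>b\<close> form a thin pair: \<open>b\<close> is the only out-neighbour of \<open>a\<close>, and \<open>a\<close> the only in-neighbour
  of \<open>b\<close>. Using this for an arbitrary \<open>v\<close> and then for the noncritical vertex just found, one gets two
  noncritical vertices unless there is a thin pair \<open>h1\<close>, \<open>h2\<close>.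

  For a thin pair let \<open>A\<close> be the in-neighbours of \<open>h1\<close>, \<open>B\<close> the out-neighbours of \<open>h2\<close>, \<open>C\<close> their
  intersection and \<open>W\<close> the vertices outside both. The degree condition gives \<open>|C| \<ge> |W| + 2\<close>. If
  deleting \<open>c \<in> C\<close> destroys strong connectivity, some vertices are cut off from \<open>h1\<close> or from \<open>h2\<close>;
  the vertices cut off by different \<open>c\<close> are disjoint. When few of them lie in \<open>W\<close>, the one farthest
  from \<open>h1\<close> (or \<open>h2\<close>) is noncritical, and since \<open>W\<close> is small this happens for enough \<open>c\<close>.\<close>

section \<open>Strong vertex sets of a relation\<close>

text \<open>Paths must stay inside \<open>X\<close>, so deleting a vertex only shrinks
  \<open>X\<close> and leaves \<open>E\<close> fixed. The empty set counts as strong.\<close>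

definition strong :: "'a rel \<Rightarrow> 'a set \<Rightarrow> bool" where
  "strong E X \<longleftrightarrow> (\<forall>u\<in>X. \<forall>v\<in>X. (u, v) \<in> (E \<inter> X \<times> X)\<^sup>*)"

lemma converse_restrict: "E\<inverse> \<inter> X \<times> X = (E \<inter> X \<times> X)\<inverse>"
  by auto

lemma strong_converse: "strong (E\<inverse>) X \<longleftrightarrow> strong E X"
  unfolding strong_def converse_restrict rtrancl_converse by auto

lemma rtrancl_restrict_mem:
  assumes "(u, v) \<in> (E \<inter> X \<times> X)\<^sup>*" and "u \<in> X"
  shows "v \<in> X"
  using assms by (induction rule: rtrancl_induct) auto

text \<open>Every vertex on a path from \<open>t\<close> to \<open>u\<close> or back is itself
  mutually reachable with \<open>t\<close>, so these paths never leave \<open>R\<close>.\<close>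

lemma strong_component:
  fixes E :: "'a rel"
  assumes "t \<in> X"
  defines "R \<equiv> {u. (t, u) \<in> (E \<inter> X \<times> X)\<^sup>* \<and> (u, t) \<in> (E \<inter> X \<times> X)\<^sup>*}"
  shows "strong E R" and "R \<subseteq> X"
proof -
  let ?F = "E \<inter> X \<times> X" and ?G = "E \<inter> R \<times> R"
  have from_t: "(t, u) \<in> ?G\<^sup>*" if "(t, u) \<in> ?F\<^sup>*" "(u, t) \<in> ?F\<^sup>*" for u
    using that
  proof (induction rule: rtrancl_induct)
    case (step y z)
    then have "(y, t) \<in> ?F\<^sup>*"
      by (meson converse_rtrancl_into_rtrancl)
    moreover have "(t, z) \<in> ?F\<^sup>*"
      using step by (meson rtrancl.rtrancl_into_rtrancl)
    ultimately have "(y, z) \<in> ?G"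
      using step by (auto simp: R_def)
    with step \<open>(y, t) \<in> ?F\<^sup>*\<close> show ?case
      by (meson rtrancl.rtrancl_into_rtrancl)
  qed simp
  have to_t: "(u, t) \<in> ?G\<^sup>*" if "(u, t) \<in> ?F\<^sup>*" "(t, u) \<in> ?F\<^sup>*" for u
    using that
  proof (induction rule: converse_rtrancl_induct)
    case (step y z)
    then have "(t, z) \<in> ?F\<^sup>*"
      by (meson rtrancl.rtrancl_into_rtrancl)
    moreover have "(y, t) \<in> ?F\<^sup>*"
      using step by (meson converse_rtrancl_into_rtrancl)
    ultimately have "(y, z) \<in> ?G"
      using step by (auto simp: R_def)
    with step \<open>(t, z) \<in> ?F\<^sup>*\<close> show ?case
      by (meson converse_rtrancl_into_rtrancl)
  qed simp
  show "strong E R"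
    unfolding strong_def
  proof (intro ballI)
    fix u v assume "u \<in> R" "v \<in> R"
    then have "(u, t) \<in> ?G\<^sup>*" "(t, v) \<in> ?G\<^sup>*"
      using from_t to_t unfolding R_def by blast+
    then show "(u, v) \<in> ?G\<^sup>*"
      by (rule rtrancl_trans)
  qed
  show "R \<subseteq> X"
    using rtrancl_restrict_mem[OF _ assms(1)] unfolding R_def by blast
qed

definition distance :: "'a rel \<Rightarrow> 'a \<Rightarrow> 'a \<Rightarrow> nat" where
  "distance E r u = (LEAST n. (u, r) \<in> E ^^ n)"

text \<open>A shortest path from \<open>u\<close> cannot meet a vertex that is at least as far from \<open>r\<close>.\<close>

lemma closer_avoids:
  assumes "(u, r) \<in> E\<^sup>*" "u \<noteq> z" "distance E r u \<le> distance E r z" "E \<subseteq> V \<times> V"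
  shows "(u, r) \<in> (E \<inter> (V - {z}) \<times> (V - {z}))\<^sup>*"
  using assms(1-3)
proof (induction "distance E r u" arbitrary: u rule: less_induct)
  case less
  obtain m where "(u, r) \<in> E ^^ m"
    using less.prems rtrancl_imp_relpow by blast
  then have d: "(u, r) \<in> E ^^ distance E r u"
    unfolding distance_def by (rule LeastI)
  show ?case
  proof (cases "distance E r u")
    case 0
    then show ?thesis using d by simp
  next
    case (Suc k)
    then obtain y where y: "(u, y) \<in> E" "(y, r) \<in> E ^^ k"
      using d relpow_Suc_D2[of u r k E] by auto
    then have "distance E r y \<le> k"
      unfolding distance_def by (simp add: Least_le)
    then have lt: "distance E r y < distance E r u"
      using Suc by simp
    then have "y \<noteq> z"
      using less.prems by auto
    moreover have "(y, r) \<in> E\<^sup>*"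
      using y relpow_imp_rtrancl by blast
    ultimately have "(y, r) \<in> (E \<inter> (V - {z}) \<times> (V - {z}))\<^sup>*"
      using less lt by simp
    moreover have "(u, y) \<in> E \<inter> (V - {z}) \<times> (V - {z})"
      using y \<open>y \<noteq> z\<close> less.prems assms(4) by auto
    ultimately show ?thesis
      by (meson converse_rtrancl_into_rtrancl)
  qed
qed

section \<open>Thin pairs\<close>

text \<open>\<open>large\<close> is the degree condition for the arc from \<open>h1\<close> to
  \<open>h2\<close>: each end has the other as one further neighbour, and these two absorb the
  \<open>+ 2\<close>.\<close>

locale thin_pair =
  fixes V :: "'a set" and E :: "'a rel" and h1 h2 :: 'a
  assumes finV: "finite V" and EV: "E \<subseteq> V \<times> V" and strongV: "strong E V"
    and neq: "h1 \<noteq> h2" and arc: "(h1, h2) \<in> E"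
    and out_h1: "(h1, u) \<in> E \<Longrightarrow> u = h2" and in_h2: "(u, h2) \<in> E \<Longrightarrow> u = h1"
    and large: "card V \<le> card {u. (u, h1) \<in> E \<and> u \<noteq> h2} + card {u. (h2, u) \<in> E \<and> u \<noteq> h1}"
begin

definition "A = {u. (u, h1) \<in> E \<and> u \<noteq> h2}"
definition "B = {u. (h2, u) \<in> E \<and> u \<noteq> h1}"
definition "C = A \<inter> B"
definition "W = V - {h1, h2} - (A \<union> B)"
text \<open>\<open>Ocut\<close> and \<open>Icut\<close> are the obstructions to deleting
  \<open>c\<close> in \<open>C\<close>: if both are empty, \<open>c\<close> is noncritical.\<close>

definition "Ocut c = {u \<in> V - {c}. (u, h1) \<notin> (E \<inter> (V - {c}) \<times> (V - {c}))\<^sup>*}"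
definition "Icut c = {u \<in> V - {c}. (h2, u) \<notin> (E \<inter> (V - {c}) \<times> (V - {c}))\<^sup>*}"

text \<open>Reversing all arcs swaps \<open>A\<close> with \<open>B\<close> and \<open>Ocut\<close>
  with \<open>Icut\<close>, so each result about \<open>Ocut\<close> yields one about
  \<open>Icut\<close>.\<close>

lemma dual: "thin_pair V (E\<inverse>) h2 h1"
proof unfold_locales
  show "card V \<le> card {u. (u, h2) \<in> E\<inverse> \<and> u \<noteq> h1} + card {u. (h1, u) \<in> E\<inverse> \<and> u \<noteq> h2}"
    using large by (simp add: add.commute)
qed (use finV EV strongV neq arc in \<open>auto simp: strong_converse dest: out_h1 in_h2\<close>)

lemma dual_defs:
  "thin_pair.A (E\<inverse>) h2 h1 = B" "thin_pair.B (E\<inverse>) h2 h1 = A"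
  "thin_pair.C (E\<inverse>) h2 h1 = C" "thin_pair.W V (E\<inverse>) h2 h1 = W"
  "thin_pair.Ocut V (E\<inverse>) h2 = Icut" "thin_pair.Icut V (E\<inverse>) h1 = Ocut"
proof -
  interpret d: thin_pair V "E\<inverse>" h2 h1 by (rule dual)
  show A: "d.A = B" and B: "d.B = A"
    by (auto simp: d.A_def d.B_def A_def B_def)
  show "d.C = C" "d.W = W"
    unfolding d.C_def d.W_def C_def W_def A B by auto
  show "d.Ocut = Icut" "d.Icut = Ocut"
    unfolding d.Ocut_def d.Icut_def Ocut_def Icut_def converse_restrict rtrancl_converse
    by auto
qed

lemma hV: "h1 \<in> V" "h2 \<in> V"
  using arc EV by auto

lemma A_sub: "A \<subseteq> V - {h1, h2}"
  using EV neq by (auto simp: A_def dest: out_h1)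

lemma B_sub: "B \<subseteq> V - {h1, h2}"
  using EV neq by (auto simp: B_def dest: in_h2)

text \<open>Inclusion-exclusion: \<open>A\<close> and \<open>B\<close> have together at least
  \<open>card V\<close> elements, but their union has only
  \<open>card V - 2 - card W\<close>.\<close>

lemma card_C: "card W + 2 \<le> card C"
proof -
  have fin: "finite A" "finite B"
    using A_sub B_sub finV finite_subset by blast+
  have "card A + card B = card (A \<union> B) + card C"
    unfolding C_def using fin by (rule card_Un_Int)
  moreover have "card W = card (V - {h1, h2}) - card (A \<union> B)"
    unfolding W_def using A_sub B_sub fin by (intro card_Diff_subset) auto
  moreover have "card (A \<union> B) \<le> card (V - {h1, h2})"
    using A_sub B_sub finV by (intro card_mono) auto
  moreover have "card (V - {h1, h2}) + 2 = card V"
  proof -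
    have "card {h1, h2} = 2" using neq by simp
    moreover have "card {h1, h2} \<le> card V" using hV finV by (intro card_mono) auto
    ultimately show ?thesis using hV finV by (simp add: card_Diff_subset)
  qed
  ultimately show ?thesis
    using large unfolding A_def[symmetric] B_def[symmetric] by linarith
qed

lemma finite_C: "finite C"
  using A_sub finV finite_subset unfolding C_def by blast

lemma other_C: "\<exists>c'\<in>C. c' \<noteq> c"
proof (rule ccontr)
  assume "\<not> ?thesis"
  then have "C \<subseteq> {c}" by auto
  then have "card C \<le> 1" by (metis card.empty card.insert card_mono empty_iff finite.intros One_nat_def)
  then show False using card_C by simp
qed

lemma reach_h1_direct:
  assumes "u \<in> A" "u \<noteq> z" "z \<noteq> h1"
  shows "(u, h1) \<in> (E \<inter> (V - {z}) \<times> (V - {z}))\<^sup>*"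
  using assms EV unfolding A_def by auto

lemma reach_from_h2_direct:
  assumes "u \<in> B" "u \<noteq> z" "z \<noteq> h2"
  shows "(h2, u) \<in> (E \<inter> (V - {z}) \<times> (V - {z}))\<^sup>*"
  using assms EV unfolding B_def by auto

lemma reach_h2_h1:
  assumes "z \<noteq> h1" "z \<noteq> h2"
  shows "(h2, h1) \<in> (E \<inter> (V - {z}) \<times> (V - {z}))\<^sup>*"
proof -
  obtain c where "c \<in> C" "c \<noteq> z" using other_C by blast
  then show ?thesis
    using reach_h1_direct reach_from_h2_direct assms unfolding C_def
    by (meson IntE rtrancl_trans)
qed

section \<open>Vertices cut off by one deletion\<close>

lemma Ocut_sub:
  assumes "c \<in> C"
  shows "Ocut c \<subseteq> W \<union> (B - A)"
proof
  fix u assume u: "u \<in> Ocut c"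
  have c: "c \<noteq> h1" "c \<noteq> h2"
    using assms A_sub unfolding C_def by auto
  have "u \<noteq> h1"
    using u unfolding Ocut_def by auto
  moreover have "u \<noteq> h2"
    using u reach_h2_h1[OF c] unfolding Ocut_def by auto
  moreover have "u \<notin> A"
    using u reach_h1_direct[of u c] c unfolding Ocut_def by auto
  ultimately show "u \<in> W \<union> (B - A)"
    using u unfolding Ocut_def W_def by auto
qed

text \<open>On a path from \<open>u\<close> to \<open>h1\<close>, whichever of \<open>c\<close> and
  \<open>c'\<close> is met first has an arc to \<open>h1\<close>, and this detour avoids the
  other.\<close>

lemma Ocut_disjoint:
  assumes "c \<in> C" "c' \<in> C" "c \<noteq> c'"
  shows "Ocut c \<inter> Ocut c' = {}"
proof -
  have "u \<notin> Ocut c \<or> u \<notin> Ocut c'" if "u \<in> V" for u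
  proof -
    have "(u, h1) \<in> E\<^sup>*"
      using strongV hV that unfolding strong_def by (meson Int_lower1 rtrancl_mono subsetD)
    then show ?thesis
    proof (induction rule: converse_rtrancl_induct)
      case base
      then show ?case by (simp add: Ocut_def)
    next
      case (step y z)
      have A: "c \<in> A" "c' \<in> A" using assms by (auto simp: C_def)
      then have h: "c \<noteq> h1" "c' \<noteq> h1" using A_sub by auto
      consider "y = c" | "y = c'" | "z = c" "y \<noteq> c" "y \<noteq> c'" | "z = c'" "y \<noteq> c" "y \<noteq> c'"
        | "y \<noteq> c" "y \<noteq> c'" "z \<noteq> c" "z \<noteq> c'" by blast
      then show ?case
      proof cases
        case 3
        then have "(y, c) \<in> E \<inter> (V - {c'}) \<times> (V - {c'})"
          using step EV assms by auto
        then have "(y, h1) \<in> (E \<inter> (V - {c'}) \<times> (V - {c'}))\<^sup>*"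
          using reach_h1_direct[OF A(1) assms(3) h(2)] by (meson converse_rtrancl_into_rtrancl)
        then show ?thesis by (simp add: Ocut_def)
      next
        case 4
        then have "(y, c') \<in> E \<inter> (V - {c}) \<times> (V - {c})"
          using step EV assms by auto
        then have "(y, h1) \<in> (E \<inter> (V - {c}) \<times> (V - {c}))\<^sup>*"
          using reach_h1_direct[OF A(2) assms(3)[symmetric] h(1)] by (meson converse_rtrancl_into_rtrancl)
        then show ?thesis by (simp add: Ocut_def)
      next
        case 5
        have "y \<notin> Ocut d" if "z \<notin> Ocut d" "d \<noteq> y" "d \<noteq> z" for d
        proof -
          have "(y, z) \<in> E \<inter> (V - {d}) \<times> (V - {d})"
            using step EV that by auto
          moreover have "(z, h1) \<in> (E \<inter> (V - {d}) \<times> (V - {d}))\<^sup>*"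
            using that step EV unfolding Ocut_def by auto
          ultimately show ?thesis
            unfolding Ocut_def by (auto intro: converse_rtrancl_into_rtrancl)
        qed
        then show ?thesis using step 5 by auto
      qed (auto simp: Ocut_def)
    qed
  qed
  then show ?thesis unfolding Ocut_def by blast
qed

text \<open>Every path can be routed through the arc from \<open>h1\<close> to
  \<open>h2\<close>.\<close>

lemma strong_deleteI:
  assumes "z \<noteq> h1" "z \<noteq> h2"
    and "\<And>u. u \<in> V - {z} \<Longrightarrow> (u, h1) \<in> (E \<inter> (V - {z}) \<times> (V - {z}))\<^sup>*"
    and "\<And>u. u \<in> V - {z} \<Longrightarrow> (h2, u) \<in> (E \<inter> (V - {z}) \<times> (V - {z}))\<^sup>*"
  shows "strong E (V - {z})"
  unfolding strong_def
proof (intro ballI)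
  fix u v assume "u \<in> V - {z}" "v \<in> V - {z}"
  then have "(u, h1) \<in> (E \<inter> (V - {z}) \<times> (V - {z}))\<^sup>*" "(h2, v) \<in> (E \<inter> (V - {z}) \<times> (V - {z}))\<^sup>*"
    using assms by auto
  moreover have "(h1, h2) \<in> E \<inter> (V - {z}) \<times> (V - {z})"
    using arc hV assms by auto
  ultimately show "(u, v) \<in> (E \<inter> (V - {z}) \<times> (V - {z}))\<^sup>*"
    by (meson rtrancl_trans rtrancl.rtrancl_into_rtrancl)
qed

text \<open>The deleted vertex is one of \<open>Ocut c\<close> at maximal distance to \<open>h1\<close>. The hypothesis on \<open>W\<close>
  forces its out-neighbours into \<open>B\<close>, so that paths from \<open>h2\<close> can bypass it.\<close>

lemma noncritical_in_Ocut:
  assumes c: "c \<in> C" and ne: "Ocut c \<noteq> {}"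
    and few: "card (Ocut c \<inter> W) + card (Ocut c \<inter> W - (\<Union>d\<in>C. Icut d)) \<le> 1"
  shows "\<exists>z\<in>Ocut c. strong E (V - {z})"
proof -
  have finO: "finite (Ocut c)" using finV by (simp add: Ocut_def)
  obtain z where z: "z \<in> Ocut c" and max: "\<And>u. u \<in> Ocut c \<Longrightarrow> distance E h1 u \<le> distance E h1 z"
    using finO ne obtains_MAX by (metis (no_types, lifting) Max_ge finite_imageI image_eqI)
  have cne: "c \<noteq> h1" "c \<noteq> h2" "c \<in> A" "c \<in> B" "c \<in> V"
    using c A_sub unfolding C_def by auto
  have zV: "z \<in> V" "z \<noteq> c" and znA: "z \<notin> A"
    using z Ocut_sub[OF c] unfolding Ocut_def W_def by auto
  have zne: "z \<noteq> h1" "z \<noteq> h2"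
    using z Ocut_sub[OF c] B_sub unfolding W_def by auto
  let ?F = "E \<inter> (V - {z}) \<times> (V - {z})"
  have reach: "(u, v) \<in> E\<^sup>*" if "u \<in> V" "v \<in> V" for u v
    using strongV that unfolding strong_def by (meson Int_lower1 rtrancl_mono subsetD)
  have out: "y \<in> Ocut c \<or> y = c" if "(u, y) \<in> E" "u \<in> Ocut c" for u y
  proof (rule ccontr)
    assume n: "\<not> ?thesis"
    then have "(y, h1) \<in> (E \<inter> (V - {c}) \<times> (V - {c}))\<^sup>*"
      using that EV unfolding Ocut_def by auto
    moreover have "(u, y) \<in> E \<inter> (V - {c}) \<times> (V - {c})"
      using n that EV unfolding Ocut_def by auto
    ultimately have "(u, h1) \<in> (E \<inter> (V - {c}) \<times> (V - {c}))\<^sup>*"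
      by (meson converse_rtrancl_into_rtrancl)
    then show False using that by (simp add: Ocut_def)
  qed
  have outB: "y \<in> B" if zy: "(z, y) \<in> E" and yz: "y \<noteq> z" for y
  proof (rule ccontr)
    assume nB: "y \<notin> B"
    then have yO: "y \<in> Ocut c" using out[OF zy z] cne by auto
    then have yW: "y \<in> Ocut c \<inter> W" using Ocut_sub[OF c] nB by auto
    \<comment> \<open>Now \<open>few\<close> leaves \<open>y\<close> as the only vertex of
      \<open>Ocut c\<close> in \<open>W\<close> and puts it into some \<open>Icut d\<close>. Hence
      \<open>z\<close> lies in \<open>B\<close>, and the path \<open>h2\<close>, \<open>z\<close>,
      \<open>y\<close> avoids \<open>d\<close>, a contradiction.\<close>
    then have pos: "card (Ocut c \<inter> W) \<noteq> 0" using finO by auto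
    then have one: "card (Ocut c \<inter> W) = 1" and "card (Ocut c \<inter> W - (\<Union>d\<in>C. Icut d)) = 0"
      using few by linarith+
    then have "Ocut c \<inter> W - (\<Union>d\<in>C. Icut d) = {}" using finO by simp
    then obtain d where d: "d \<in> C" "y \<in> Icut d" using yW by auto
    have "z \<notin> W"
      using one yW yz z by (metis IntI card_1_singletonE singletonD)
    then have "z \<in> B" using z Ocut_sub[OF c] by auto
    have dz: "d \<noteq> z" using d znA by (auto simp: C_def)
    have "d \<noteq> h2" using d A_sub by (auto simp: C_def)
    then have "(h2, z) \<in> (E \<inter> (V - {d}) \<times> (V - {d}))\<^sup>*"
      using reach_from_h2_direct[OF \<open>z \<in> B\<close>] dz by auto
    moreover have "(z, y) \<in> E \<inter> (V - {d}) \<times> (V - {d})"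
      using zy dz d EV by (auto simp: Icut_def)
    ultimately have "(h2, y) \<in> (E \<inter> (V - {d}) \<times> (V - {d}))\<^sup>*"
      by (meson rtrancl.rtrancl_into_rtrancl)
    then show False using d by (simp add: Icut_def)
  qed
  have "strong E (V - {z})"
  proof (rule strong_deleteI[OF zne])
    fix u assume u: "u \<in> V - {z}"
    show "(u, h1) \<in> ?F\<^sup>*"
    proof (cases "u \<in> Ocut c")
      case True
      then show ?thesis
        using closer_avoids[OF reach, of u h1 z V] u max EV hV by auto
    next
      case False
      show ?thesis
      proof (cases "u = c")
        case True
        then show ?thesis using reach_h1_direct[OF cne(3)] zV zne by auto
      next
        case uc: False
        with False have "(u, h1) \<in> (E \<inter> (V - {c}) \<times> (V - {c}))\<^sup>*"
          using u by (auto simp: Ocut_def)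
        then show ?thesis using u uc
        proof (induction rule: converse_rtrancl_induct)
          case (step y y')
          \<comment> \<open>A vertex that reaches \<open>h1\<close> without \<open>c\<close> lies
            outside \<open>Ocut c\<close>, unlike \<open>z\<close>.\<close>
          have "y' \<noteq> z"
            using step(2) z by (auto simp: Ocut_def)
          then show ?case
            using step by (auto intro: converse_rtrancl_into_rtrancl)
        qed simp
      qed
    qed
  next
    fix u assume u: "u \<in> V - {z}"
    have "(h2, u) \<in> E\<^sup>*" using reach hV u by auto
    then show "(h2, u) \<in> ?F\<^sup>*" using u
    proof (induction rule: rtrancl_induct)
      case (step y y')
      show ?case
      proof (cases "y = z")
        case True
        then show ?thesis using outB reach_from_h2_direct step zne by auto
      next
        case False
        then have "(h2, y) \<in> ?F\<^sup>*" "(y, y') \<in> ?F" using step EV by auto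
        then show ?thesis by (rule rtrancl.rtrancl_into_rtrancl)
      qed
    qed simp
  qed
  then show ?thesis using z by blast
qed

lemma noncritical_in_Icut:
  assumes "c \<in> C" "Icut c \<noteq> {}"
    and "card (Icut c \<inter> W) + card (Icut c \<inter> W - (\<Union>d\<in>C. Ocut d)) \<le> 1"
  shows "\<exists>z\<in>Icut c. strong E (V - {z})"
  using thin_pair.noncritical_in_Ocut[OF dual, unfolded dual_defs strong_converse, OF assms] .

lemmas Icut_sub = thin_pair.Ocut_sub[OF dual, unfolded dual_defs]
lemmas Icut_disjoint = thin_pair.Ocut_disjoint[OF dual, unfolded dual_defs]

text \<open>Every vertex of \<open>W\<close> carries two units of charge: one for its \<open>Ocut\<close> and one for its \<open>Icut\<close>
  if it lies in both kinds, otherwise two for the only one.\<close>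

definition "charge c =
  card (Ocut c \<inter> W) + card (Ocut c \<inter> W - (\<Union>d\<in>C. Icut d)) +
  (card (Icut c \<inter> W) + card (Icut c \<inter> W - (\<Union>d\<in>C. Ocut d)))"

text \<open>By disjointness a vertex of \<open>W\<close> lies in at most one \<open>Ocut\<close> and
  at most one \<open>Icut\<close>, so it is charged exactly twice if it is cut off at all.\<close>

lemma sum_charge: "(\<Sum>c\<in>C. charge c) \<le> 2 * card W"
proof -
  let ?O = "\<Union>d\<in>C. Ocut d" and ?I = "\<Union>d\<in>C. Icut d"
  have finW: "finite W" using finV by (simp add: W_def)
  have *: "(\<Sum>c\<in>C. card (F c \<inter> X)) = card ((\<Union>c\<in>C. F c) \<inter> X)"
    if "finite X" and "\<And>c d. c \<in> C \<Longrightarrow> d \<in> C \<Longrightarrow> c \<noteq> d \<Longrightarrow> F c \<inter> F d = {}" for F and X :: "'a set"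
  proof -
    have "card (\<Union>c\<in>C. F c \<inter> X) = (\<Sum>c\<in>C. card (F c \<inter> X))"
      using that finite_C by (intro card_UN_disjoint) blast+
    then show ?thesis by (simp add: Int_UN_distrib2)
  qed
  have "(\<Sum>c\<in>C. charge c) = card (?O \<inter> W) + card (?O \<inter> (W - ?I)) + (card (?I \<inter> W) + card (?I \<inter> (W - ?O)))"
    unfolding charge_def Int_Diff sum.distrib
    using finW Ocut_disjoint Icut_disjoint by (simp add: *)
  also have "card (?O \<inter> W) + card (?I \<inter> (W - ?O)) = card ((?O \<union> ?I) \<inter> W)"
    using finW by (subst card_Un_disjoint[symmetric]) (auto intro!: arg_cong[where f = card])
  then have "card (?O \<inter> W) + card (?O \<inter> (W - ?I)) + (card (?I \<inter> W) + card (?I \<inter> (W - ?O)))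
     = card ((?O \<union> ?I) \<inter> W) + (card (?I \<inter> W) + card (?O \<inter> (W - ?I)))"
    by simp
  also have "card (?I \<inter> W) + card (?O \<inter> (W - ?I)) = card ((?O \<union> ?I) \<inter> W)"
    using finW by (subst card_Un_disjoint[symmetric]) (auto intro!: arg_cong[where f = card])
  also have "card ((?O \<union> ?I) \<inter> W) \<le> card W"
    using finW by (intro card_mono) auto
  finally show ?thesis by simp
qed

text \<open>A charge of at most 1 gives the smallness hypothesis for both cuts of \<open>c\<close>.
  If both are empty, \<open>c\<close> itself can be deleted.\<close>

lemma charge_deficient:
  assumes "c \<in> C" "charge c \<le> 1"
  shows "\<exists>z. (z = c \<or> z \<in> Ocut c \<or> z \<in> Icut c) \<and> z \<in> V \<and> strong E (V - {z})"
proof -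
  have V: "Ocut c \<subseteq> V" "Icut c \<subseteq> V" by (auto simp: Ocut_def Icut_def)
  consider "Ocut c \<noteq> {}" | "Icut c \<noteq> {}" | "Ocut c = {}" "Icut c = {}" by blast
  then show ?thesis
  proof cases
    case 1
    then show ?thesis using noncritical_in_Ocut[of c] assms V unfolding charge_def by fastforce
  next
    case 2
    then show ?thesis using noncritical_in_Icut[of c] assms V unfolding charge_def by fastforce
  next
    case 3
    have "c \<in> V" "c \<noteq> h1" "c \<noteq> h2" using assms A_sub by (auto simp: C_def)
    moreover from this have "strong E (V - {c})"
      using 3 by (intro strong_deleteI) (auto simp: Ocut_def Icut_def)
    ultimately show ?thesis by blast
  qed
qed

lemma two_noncritical:
  "\<exists>u v. u \<noteq> v \<and> u \<in> V \<and> v \<in> V \<and> strong E (V - {u}) \<and> strong E (V - {v})"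
proof (rule ccontr)
  assume neg: "\<not> ?thesis"
  define D0 where "D0 = {c \<in> C. charge c = 0}"
  define D1 where "D1 = {c \<in> C. charge c = 1}"
  have fin: "finite D0" "finite D1" using finite_C by (auto simp: D0_def D1_def)
  \<comment> \<open>The total charge is at least 4 below \<open>2 * card C\<close>. An element of
    \<open>D0\<close> accounts for 2 of this deficit, one of \<open>D1\<close> for 1.\<close>
  have count: "4 \<le> 2 * card D0 + card D1"
  proof -
    have "2 * card C = (\<Sum>c\<in>C. 2)" by simp
    also have "\<dots> \<le> (\<Sum>c\<in>C. charge c + (2 * (if c \<in> D0 then 1 else 0) + (if c \<in> D1 then 1 else 0)))"
      by (intro sum_mono) (auto simp: D0_def D1_def)
    also have "\<dots> = (\<Sum>c\<in>C. charge c) + (2 * card (C \<inter> D0) + card (C \<inter> D1))"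
      using finite_C by (simp add: sum.distrib sum_distrib_left[symmetric] sum.If_cases)
    also have "C \<inter> D0 = D0" by (auto simp: D0_def)
    also have "C \<inter> D1 = D1" by (auto simp: D1_def)
    finally show ?thesis using sum_charge card_C by linarith
  qed
  have disj: "card (D0 \<union> D1) = card D0 + card D1"
    using fin by (intro card_Un_disjoint) (auto simp: D0_def D1_def)
  have sub: "D0 \<union> D1 \<subseteq> C" by (auto simp: D0_def D1_def)
  have ex: "\<exists>z. (z = c \<or> z \<in> Ocut c \<or> z \<in> Icut c) \<and> z \<in> V \<and> strong E (V - {z})" if "c \<in> D0 \<union> D1" for c
    using charge_deficient[of c] that by (auto simp: D0_def D1_def)
  have "D0 \<union> D1 \<noteq> {}" using count by auto
  then obtain v where v: "v \<in> V" "strong E (V - {v})" using ex by blast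
  \<comment> \<open>If \<open>v\<close> is the only noncritical vertex, it is the one supplied for
    every such \<open>c\<close>.\<close>
  have mem: "v = c \<or> v \<in> Ocut c \<or> v \<in> Icut c" if "c \<in> D0 \<union> D1" for c
    using ex[OF that] neg v by metis
  define DO where "DO = {c \<in> D0 \<union> D1. v \<in> Ocut c}"
  define DI where "DI = {c \<in> D0 \<union> D1. v \<in> Icut c}"
  have cDO: "card DO \<le> 1"
    using Ocut_disjoint sub fin by (intro card_le_Suc0_iff_eq[THEN iffD2, folded One_nat_def]) (auto simp: DO_def)
  have cDI: "card DI \<le> 1"
    using Icut_disjoint sub fin by (intro card_le_Suc0_iff_eq[THEN iffD2, folded One_nat_def]) (auto simp: DI_def)
  have "v \<notin> C"
  proof
    assume "v \<in> C"
    then have "v \<notin> Ocut c" "v \<notin> Icut c" if "c \<in> C" for c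
      using Ocut_sub[OF that] Icut_sub[OF that] by (auto simp: C_def W_def)
    then have "D0 \<union> D1 \<subseteq> {v}" using mem sub by blast
    then have "card (D0 \<union> D1) \<le> card {v}" by (intro card_mono) auto
    then show False using disj count by simp
  qed
  then have un: "D0 \<union> D1 = DO \<union> DI" using mem sub by (auto simp: DO_def DI_def)
  then have "card (D0 \<union> D1) \<le> card DO + card DI" by (simp add: card_Un_le)
  \<comment> \<open>At most two elements remain, one per kind of cut, so \<open>count\<close> forces
    two elements of \<open>D0\<close> and one cut of each kind.\<close>
  then have "card D1 = 0" "card DO \<noteq> 0" "card DI \<noteq> 0"
    using cDO cDI disj count by linarith+
  then obtain c d where "c \<in> D0" "v \<in> Ocut c" "d \<in> D0" "v \<in> Icut d"
    using fin by (auto simp: DO_def DI_def card_eq_0_iff)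
  \<comment> \<open>Charge 0 keeps \<open>Ocut c\<close> and \<open>Icut d\<close> out of
    \<open>W\<close>, hence inside the disjoint sets \<open>B - A\<close> and
    \<open>A - B\<close>.\<close>
  moreover from this have "v \<notin> W"
    using finV by (auto simp: D0_def charge_def W_def)
  ultimately show False
    using Ocut_sub[of c] Icut_sub[of d] by (auto simp: D0_def)
qed

end

section \<open>Maximal strong sets\<close>

text \<open>If \<open>a\<close> and \<open>a'\<close> differ, a shortest path from \<open>a\<close>
  to \<open>t\<close> avoids \<open>a'\<close>. The component of \<open>t\<close> in
  \<open>V - {a'}\<close> then contains \<open>T\<close> and \<open>a\<close>, against
  maximality.\<close>

lemma entry_unique_aux:
  assumes "E \<subseteq> V \<times> V" "strong E V" "T \<subseteq> V" "strong E T"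
    and maximal: "\<And>R. strong E R \<Longrightarrow> T \<subset> R \<Longrightarrow> R \<subseteq> V \<Longrightarrow> R = V"
    and t: "t \<in> T" and a: "s \<in> T" "(s, a) \<in> E" "a \<notin> T" and a': "a' \<in> V" "a' \<notin> T"
    and le: "distance E t a \<le> distance E t a'"
  shows "a = a'"
proof (rule ccontr)
  assume ne: "a \<noteq> a'"
  let ?X = "V - {a'}"
  define R where "R = {u. (t, u) \<in> (E \<inter> ?X \<times> ?X)\<^sup>* \<and> (u, t) \<in> (E \<inter> ?X \<times> ?X)\<^sup>*}"
  have tX: "t \<in> ?X" using assms by auto
  have TR: "T \<subseteq> R"
  proof
    fix u assume "u \<in> T"
    then have "(t, u) \<in> (E \<inter> T \<times> T)\<^sup>*" "(u, t) \<in> (E \<inter> T \<times> T)\<^sup>*"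
      using assms(4) t unfolding strong_def by auto
    moreover have "(E \<inter> T \<times> T)\<^sup>* \<subseteq> (E \<inter> ?X \<times> ?X)\<^sup>*"
      using assms(3) a' by (intro rtrancl_mono) auto
    ultimately show "u \<in> R" unfolding R_def by blast
  qed
  have "a \<in> V" "t \<in> V" using a assms(1) tX by auto
  then have "(a, t) \<in> (E \<inter> V \<times> V)\<^sup>*"
    using assms(2) unfolding strong_def by blast
  then have "(a, t) \<in> E\<^sup>*"
    by (meson Int_lower1 rtrancl_mono subsetD)
  then have "(a, t) \<in> (E \<inter> ?X \<times> ?X)\<^sup>*"
    by (rule closer_avoids[OF _ ne le assms(1)])
  moreover have "(t, s) \<in> (E \<inter> ?X \<times> ?X)\<^sup>*" "(s, a) \<in> E \<inter> ?X \<times> ?X"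
    using TR a a' ne assms(1) unfolding R_def by auto
  ultimately have "a \<in> R"
    unfolding R_def by (auto intro: rtrancl.rtrancl_into_rtrancl)
  with TR have "R = V"
    using maximal[of R] strong_component[OF tX, of E, folded R_def] a by blast
  then show False using strong_component(2)[OF tX, of E, folded R_def] a' by blast
qed

lemma entry_unique:
  assumes "E \<subseteq> V \<times> V" "strong E V" "T \<subseteq> V" "strong E T"
    and "\<And>R. strong E R \<Longrightarrow> T \<subset> R \<Longrightarrow> R \<subseteq> V \<Longrightarrow> R = V"
    and "s \<in> T" "(s, a) \<in> E" "a \<notin> T" and "s' \<in> T" "(s', a') \<in> E" "a' \<notin> T"
  shows "a = a'"
proof -
  have V: "a \<in> V" "a' \<in> V" using assms(1,7,10) by auto
  show ?thesis
  proof (cases "distance E s a \<le> distance E s a'")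
    case True
    show ?thesis
      by (rule entry_unique_aux[OF assms(1-6) assms(6-8) V(2) assms(11) True])
  next
    case False
    then have "distance E s a' \<le> distance E s a" by simp
    from entry_unique_aux[OF assms(1-6) assms(9-11) V(1) assms(8) this] show ?thesis by simp
  qed
qed

lemma exit_unique:
  assumes "E \<subseteq> V \<times> V" "strong E V" "T \<subseteq> V" "strong E T"
    and "\<And>R. strong E R \<Longrightarrow> T \<subset> R \<Longrightarrow> R \<subseteq> V \<Longrightarrow> R = V"
    and "s \<in> T" "(b, s) \<in> E" "b \<notin> T" and "s' \<in> T" "(b', s') \<in> E" "b' \<notin> T"
  shows "b = b'"
  by (rule entry_unique[of "E\<inverse>" V T s b s' b']) (use assms in \<open>auto simp: strong_converse\<close>)

lemma arc_leaving:
  assumes "(u, w) \<in> E\<^sup>*" "u \<in> T" "w \<notin> T"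
  shows "\<exists>s s'. s \<in> T \<and> s' \<notin> T \<and> (s, s') \<in> E"
  using assms by (induction rule: rtrancl_induct) auto

section \<open>Degree count around a maximal strong set\<close>

definition degree :: "'a rel \<Rightarrow> 'a \<Rightarrow> nat" where
  "degree E x = card {y. y \<noteq> x \<and> ((x, y) \<in> E \<or> (y, x) \<in> E)}"

lemma degree_le:
  assumes "finite X" "\<And>y. y \<noteq> x \<Longrightarrow> (x, y) \<in> E \<or> (y, x) \<in> E \<Longrightarrow> y \<in> X"
  shows "degree E x \<le> card X"
  unfolding degree_def using assms by (intro card_mono) auto

text \<open>Keeping \<open>v\<close> inside \<open>T\<close> makes the vertex found differ from
  \<open>v\<close>, so that a second application gives a second vertex.\<close>

lemma noncritical_or_thin_pair:
  assumes fin: "finite V" and EV: "E \<subseteq> V \<times> V" and irr: "\<And>x. (x, x) \<notin> E"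
    and str: "strong E V" and n: "4 \<le> card V" and v: "v \<in> V"
    and deg: "\<And>x y. (x, y) \<in> E \<Longrightarrow> card V + 2 \<le> degree E x + degree E y"
  shows "(\<exists>x\<in>V. x \<noteq> v \<and> strong E (V - {x})) \<or> (\<exists>a b. thin_pair V E a b)"
proof -
  define \<T> where "\<T> = {T. T \<subseteq> V \<and> T \<noteq> V \<and> v \<in> T \<and> strong E T}"
  have "{v} \<in> \<T>" using n v by (auto simp: \<T>_def strong_def)
  moreover have "finite \<T>" using fin by (auto simp: \<T>_def)
  ultimately obtain T where T: "T \<in> \<T>" and "\<forall>R\<in>\<T>. T \<subseteq> R \<longrightarrow> R = T"
    using finite_has_maximal[of \<T>] by auto
  then have maximal: "R = V" if "strong E R" "T \<subset> R" "R \<subseteq> V" for R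
    using that unfolding \<T>_def by blast
  have TV: "T \<subseteq> V" "T \<noteq> V" and vT: "v \<in> T" and Tstr: "strong E T"
    using T by (auto simp: \<T>_def)
  have reach: "(x, y) \<in> E\<^sup>*" if "x \<in> V" "y \<in> V" for x y
    using str that unfolding strong_def by (meson Int_lower1 rtrancl_mono subsetD)
  obtain y where y: "y \<in> V" "y \<notin> T" using TV by blast
  obtain s a where a: "s \<in> T" "(s, a) \<in> E" "a \<notin> T"
    using arc_leaving[OF reach[OF v y(1)], of T] vT y by blast
  obtain s' b where b: "s' \<in> T" "(b, s') \<in> E" "b \<notin> T"
    using arc_leaving[OF reach[OF y(1) v], of "- T"] vT y by auto
  have abV: "a \<in> V" "b \<in> V" using a b EV by auto
  have entry: "w = a" if "x \<in> T" "(x, w) \<in> E" "w \<notin> T" for x w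
    using entry_unique[OF EV str TV(1) Tstr maximal that a] by simp
  have exit: "w = b" if "x \<in> T" "(w, x) \<in> E" "w \<notin> T" for x w
    using exit_unique[OF EV str TV(1) Tstr maximal that b] by simp
  have finT: "finite T" using fin TV finite_subset by blast
  show ?thesis
  proof (cases "a = b")
    case True
    \<comment> \<open>Here \<open>insert a T\<close> is strong, so by maximality it is all of
      \<open>V\<close>.\<close>
    let ?X = "insert a T"
    define R where "R = {u. (s, u) \<in> (E \<inter> ?X \<times> ?X)\<^sup>* \<and> (u, s) \<in> (E \<inter> ?X \<times> ?X)\<^sup>*}"
    have sX: "s \<in> ?X" using a by simp
    have mono: "(E \<inter> T \<times> T)\<^sup>* \<subseteq> (E \<inter> ?X \<times> ?X)\<^sup>*" by (intro rtrancl_mono) auto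
    have TR: "T \<subseteq> R"
      using Tstr a mono unfolding strong_def R_def by blast
    have "(a, s') \<in> E \<inter> ?X \<times> ?X" using a b True by auto
    moreover have "(s', s) \<in> (E \<inter> ?X \<times> ?X)\<^sup>*" using TR b unfolding R_def by blast
    ultimately have "(a, s) \<in> (E \<inter> ?X \<times> ?X)\<^sup>*" by (rule converse_rtrancl_into_rtrancl)
    moreover have "(s, a) \<in> E \<inter> ?X \<times> ?X" using a by auto
    ultimately have "a \<in> R" unfolding R_def by blast
    then have "R = V"
      using maximal[of R] strong_component[OF sX, of E, folded R_def] a TR TV abV by blast
    then have "V - {a} = T"
      using strong_component(2)[OF sX, of E, folded R_def] TV a by blast
    then show ?thesis using Tstr abV vT a by (metis (no_types))
  next
    case ab: False
    define M where "M = V - T - {a, b}"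
    have finM: "finite M" using fin by (simp add: M_def)
    have cardV: "card V = card T + card M + 2"
    proof -
      have "V = T \<union> (M \<union> {a, b})" using TV abV by (auto simp: M_def)
      moreover have "card (T \<union> (M \<union> {a, b})) = card T + card (M \<union> {a, b})"
        using finT finM a b by (intro card_Un_disjoint) (auto simp: M_def)
      moreover have "card (M \<union> {a, b}) = card M + card {a, b}"
        using finM by (intro card_Un_disjoint) (auto simp: M_def)
      ultimately show ?thesis using ab by simp
    qed
    have out: "\<exists>w. (x, w) \<in> E" if "x \<in> V" "y \<in> V" "x \<noteq> y" for x y
      using reach[OF that(1,2)] that(3) by (meson converse_rtranclE)
    have deg_any: "degree E x \<le> card V - 1" if "x \<in> V" for x
    proof -
      have "degree E x \<le> card (V - {x})"
        using fin EV by (intro degree_le) auto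
      then show ?thesis using that fin by simp
    qed
    show ?thesis
    proof (cases "M = {}")
      case True
      then have V: "V = T \<union> {a, b}" using TV abV by (auto simp: M_def)
      \<comment> \<open>An arc from \<open>a\<close> into \<open>T\<close> would have to start in
        \<open>b\<close>, as all arcs entering \<open>T\<close> do.\<close>
      have out_a: "w = b" if "(a, w) \<in> E" for w
        using that exit[of w a] EV V a(3) irr[of a] ab by blast
      have in_b: "w = a" if "(w, b) \<in> E" for w
        using that entry[of w b] EV V b(3) irr[of b] ab by blast
      have arc: "(a, b) \<in> E" using out[of a b] abV ab out_a by blast
      have fa: "finite {u. (u, a) \<in> E \<and> u \<noteq> b}" "finite {u. (b, u) \<in> E \<and> u \<noteq> a}"
        using fin EV by (auto intro: finite_subset[of _ V])
      have "{y. y \<noteq> a \<and> ((a, y) \<in> E \<or> (y, a) \<in> E)} = insert b {u. (u, a) \<in> E \<and> u \<noteq> b}"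
        using arc out_a irr ab by blast
      then have da: "degree E a = card {u. (u, a) \<in> E \<and> u \<noteq> b} + 1"
        using fa unfolding degree_def by simp
      have "{y. y \<noteq> b \<and> ((b, y) \<in> E \<or> (y, b) \<in> E)} = insert a {u. (b, u) \<in> E \<and> u \<noteq> a}"
        using arc in_b irr ab by blast
      then have db: "degree E b = card {u. (b, u) \<in> E \<and> u \<noteq> a} + 1"
        using fa unfolding degree_def by simp
      have "thin_pair V E a b"
        by unfold_locales (use fin EV str ab arc deg[OF arc] da db in \<open>auto dest: out_a in_b\<close>)
      then show ?thesis by blast
    next
      case False
      then obtain m where m: "m \<in> M" by blast
      have degT: "degree E x \<le> card T + 1" if "x \<in> T" for x
      proof -
        have "degree E x \<le> card ((T - {x}) \<union> {a, b})"
          using finT entry[OF that] exit[OF that] by (intro degree_le) auto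
        also have "\<dots> \<le> card (T - {x}) + card {a, b}" by (rule card_Un_le)
        also have "card {a, b} = 2" using ab by simp
        also have "card (T - {x}) = card T - 1" using that finT by simp
        also have "card T - 1 + 2 = card T + 1"
          using that finT card_gt_0_iff[of T] by auto
        finally show ?thesis .
      qed
      have nbM: "y \<in> V - T" if "(x, y) \<in> E \<or> (y, x) \<in> E" "x \<in> M" for x y
        using that entry[of y x] exit[of y x] EV by (auto simp: M_def)
      have degM: "degree E x \<le> card M + 1" if "x \<in> M" for x
      proof -
        have "degree E x \<le> card ((M - {x}) \<union> {a, b})"
        proof (rule degree_le)
          fix y assume "y \<noteq> x" "(x, y) \<in> E \<or> (y, x) \<in> E"
          then have "y \<in> V - T" using nbM[OF _ that] by blast
          then show "y \<in> (M - {x}) \<union> {a, b}" using \<open>y \<noteq> x\<close> by (auto simp: M_def)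
        qed (use finM in simp)
        also have "\<dots> \<le> card (M - {x}) + card {a, b}" by (rule card_Un_le)
        also have "card {a, b} = 2" using ab by simp
        also have "card (M - {x}) = card M - 1" using that finM by simp
        also have "card M - 1 + 2 = card M + 1"
          using that finM card_gt_0_iff[of M] by auto
        finally show ?thesis .
      qed
      \<comment> \<open>Adjacent vertices of \<open>T\<close> have degree sum at most
        \<open>2 * card T + 2\<close>, while \<open>card V = card T + card M + 2\<close>. If
        \<open>T\<close> is only \<open>{v}\<close>, then \<open>v\<close> and \<open>a\<close>
        reach at most \<open>2 + (card V - 1)\<close>, one short.\<close>
      have large: "card M + 2 \<le> card T"
      proof (cases "\<exists>x. x \<in> T \<and> x \<noteq> v")
        case True
        then obtain x where "x \<in> T" "x \<noteq> v" by blast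
        then have "(v, x) \<in> (E \<inter> T \<times> T)\<^sup>*" using Tstr vT unfolding strong_def by blast
        then obtain w where "(v, w) \<in> E" "w \<in> T"
          using \<open>x \<noteq> v\<close> by (auto elim: converse_rtranclE)
        then show ?thesis using deg[of v w] degT[OF vT] degT[of w] cardV by simp
      next
        case False
        then have Tv: "T = {v}" using vT by blast
        then have "s = v" using a by simp
        then show ?thesis
          using deg[OF a(2)] degT[OF vT] deg_any[OF abV(1)] Tv n by simp
      qed
      have mV: "m \<in> V" "m \<noteq> v" using m vT by (auto simp: M_def)
      then obtain w where w: "(m, w) \<in> E" using out v by blast
      \<comment> \<open>By \<open>large\<close>, adjacent vertices inside \<open>M\<close> have too
        few neighbours. Otherwise \<open>m\<close> has only \<open>a\<close> and \<open>b\<close> as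
        neighbours, and its degree sum with \<open>w\<close> is at most
        \<open>card V + 1\<close>.\<close>
      show ?thesis
      proof (cases "\<exists>w\<in>M. (m, w) \<in> E \<or> (w, m) \<in> E")
        case True
        then obtain w where "w \<in> M" "(m, w) \<in> E \<or> (w, m) \<in> E" by blast
        then have "card V + 2 \<le> degree E m + degree E w" using deg[of m w] deg[of w m] by auto
        then show ?thesis using degM[OF m] degM[OF \<open>w \<in> M\<close>] large cardV by simp
      next
        case False
        have "degree E m \<le> card {a, b}"
        proof (rule degree_le)
          fix y assume "(m, y) \<in> E \<or> (y, m) \<in> E"
          then have "y \<in> V - T" "y \<notin> M" using nbM[OF _ m] False by blast+
          then show "y \<in> {a, b}" by (simp add: M_def)
        qed simp
        then have "degree E m \<le> 2" using ab by simp
        moreover have "w \<in> V" using w EV by auto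
        ultimately show ?thesis using deg[OF w] deg_any[of w] n by simp
      qed
    qed
  qed
qed

lemma two_strong_deletions:
  assumes "finite V" "E \<subseteq> V \<times> V" "\<And>x. (x, x) \<notin> E" "strong E V" "4 \<le> card V"
    and "\<And>x y. (x, y) \<in> E \<Longrightarrow> card V + 2 \<le> degree E x + degree E y"
  shows "\<exists>u v. u \<noteq> v \<and> u \<in> V \<and> v \<in> V \<and> strong E (V - {u}) \<and> strong E (V - {v})"
proof (cases "\<exists>a b. thin_pair V E a b")
  case True
  then obtain a b where "thin_pair V E a b" by blast
  then show ?thesis by (rule thin_pair.two_noncritical)
next
  case False
  have step: "\<exists>x\<in>V. x \<noteq> v \<and> strong E (V - {x})" if "v \<in> V" for v
    using noncritical_or_thin_pair[OF assms(1-5) that assms(6)] False by simp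
  obtain w where "w \<in> V" using assms(5) by fastforce
  then obtain u where u: "u \<in> V" "strong E (V - {u})" using step by blast
  then obtain v where "v \<in> V" "v \<noteq> u" "strong E (V - {v})" using step by blast
  with u show ?thesis by blast
qed

section \<open>Transfer to digraphs\<close>

lemma rtrancl_on_iff:
  "(x, y) \<in> rtrancl_on F r \<longleftrightarrow> x \<in> F \<and> (x, y) \<in> (r \<inter> F \<times> F)\<^sup>*"
proof
  assume "(x, y) \<in> rtrancl_on F r"
  then show "x \<in> F \<and> (x, y) \<in> (r \<inter> F \<times> F)\<^sup>*"
    by (induction rule: rtrancl_on_induct) (auto intro: rtrancl.rtrancl_into_rtrancl)
next
  assume "x \<in> F \<and> (x, y) \<in> (r \<inter> F \<times> F)\<^sup>*"
  then have "(x, y) \<in> (r \<inter> F \<times> F)\<^sup>*" "x \<in> F" by auto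
  then show "(x, y) \<in> rtrancl_on F r"
    by (induction rule: rtrancl_induct) (auto intro: rtrancl_on_into_rtrancl_on)
qed

lemma strongly_connected_iff_strong:
  "strongly_connected G \<longleftrightarrow> verts G \<noteq> {} \<and> strong (arcs_ends G) (verts G)"
  unfolding strongly_connected_def reachable_def rtrancl_on_iff strong_def by auto

lemma strongly_connected_del_vert:
  "strongly_connected (pre_digraph.del_vert G v) \<longleftrightarrow>
    verts G - {v} \<noteq> {} \<and> strong (arcs_ends G) (verts G - {v})"
proof -
  let ?X = "verts G - {v}"
  \<comment> \<open>Deletion removes only arcs that touch \<open>v\<close>.\<close>
  have "arcs_ends (pre_digraph.del_vert G v) \<inter> ?X \<times> ?X = arcs_ends G \<inter> ?X \<times> ?X"
    by (auto simp: arcs_ends_def arc_to_ends_def pre_digraph.del_vert_def)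
  then show ?thesis
    by (simp add: strongly_connected_iff_strong strong_def pre_digraph.verts_del_vert)
qed

theorem corollary2:
  fixes D :: "('a, 'b) pre_digraph" and n :: nat
  assumes "digraph D"
    and "strongly_connected D"
    and "card (verts D) = n"
    and "n \<ge> 4"
    and "\<And>x y. x \<in> verts D \<Longrightarrow> y \<in> verts D \<Longrightarrow> adjacent D x y \<Longrightarrow> deg D x + deg D y \<ge> n + 2"
  shows "\<exists>u v. u \<noteq> v \<and> noncritical D u \<and> noncritical D v"
proof -
  interpret digraph D by fact
  let ?E = "arcs_ends D" and ?V = "verts D"
  have EV: "?E \<subseteq> ?V \<times> ?V"
    by (auto simp: arcs_ends_def arc_to_ends_def)
  have irr: "(x, x) \<notin> ?E" for x
    using no_loops by (auto simp: arcs_ends_def arc_to_ends_def)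
  have deg: "deg D x = degree ?E x" for x
  proof -
    have "{y \<in> ?V. adjacent D x y} = {y. y \<noteq> x \<and> ((x, y) \<in> ?E \<or> (y, x) \<in> ?E)}"
      using EV by (auto simp: adjacent_def)
    then show ?thesis by (simp add: deg_def degree_def)
  qed
  have sum: "card ?V + 2 \<le> degree ?E x + degree ?E y" if "(x, y) \<in> ?E" for x y
  proof -
    have "x \<noteq> y" using that irr by blast
    then show ?thesis
      using assms(3) assms(5)[of x y] that EV by (auto simp: adjacent_def deg)
  qed
  have "strong ?E ?V" "4 \<le> card ?V"
    using assms(2-4) by (auto simp: strongly_connected_iff_strong)
  then obtain u v where uv: "u \<noteq> v" "u \<in> ?V" "v \<in> ?V" "strong ?E (?V - {u})" "strong ?E (?V - {v})"
    using two_strong_deletions[OF finite_verts EV irr _ _ sum] by blast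
  \<comment> \<open>Each deletion leaves the other vertex, which gives the required
    nonemptiness.\<close>
  then have "noncritical D u" "noncritical D v"
    by (auto simp: noncritical_def strongly_connected_del_vert)
  then show ?thesis using uv(1) by blast
qed

end
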